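(* Let $d,n\ge 1$ be integers with $n\ge d+3$. Then $$r(n,d)=H_{d'-1}(n,d'),\quad\text{where } d'=n-d-2.$$
   Context: A set $X\subset\mathbb{R}^d$ is in general position if every subset of at most $d+1$ of its points is affinely independent. Minimal Radon partitions: for a set $X\subset\mathbb{R}^d$ of $n$ points in general position and a partition $X=A\cup B$ into two disjoint sets, $r_X(A,B)$ is the number of subsets $S\subset X$ with $|S|=d+2$ such that $\mathrm{conv}(A\cap S)\cap\mathrm{conv}(B\cap S)\ne\emptyset$. Set $r(X)=\max r_X(A,B)$ over all partitions $X=A\cup B$, $A\cap B=\emptyset$, and $r(n,d)=\min r(X)$ over all sets $X\subset\mathbb{R}^d$ of $n$ points in general position. Projective faces: a projective transformation $T$ of $\mathbb{R}^d$ is a map of the form $T(x)=\frac{Ax+b}{\langle c,x\rangle+\delta}$, where $A$ is a linear transformation of $\mathbb{R}^d$, $b,c\in\mathbb{R}^d$, $\delta\in\mathbb{R}$, and at least one of $c\ne 0$, $\delta\ne 0$ holds. It is permissible for $X\subset\mathbb{R}^d$ if $\langle c,x\rangle+\delta\neq 0$ for all $x\in X$. For a polytope $P$, $f_k(P)$ denotes the number of $k$-dimensional faces of $P$. For integers $d\ge k\ge 0$ and a finite set $X\subset\mathbb{R}^d$ of points in general position, $h_k(X,d)=\max_T f_k(\mathrm{conv}(T(X)))$, the maximum being over all projective transformations $T$ permissible for $X$, and $H_k(n,d)=\min h_k(X,d)$, the minimum being over all sets $X\subset\mathbb{R}^d$ of $n$ points in general position. *)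

theory Defs
  imports "HOL-Analysis.Analysis"
begin

definition general_position :: "(real ^ 'd) set \<Rightarrow> bool" where
  "general_position X \<longleftrightarrow>
     (\<forall>S\<subseteq>X. finite S \<and> card S \<le> CARD('d) + 1 \<longrightarrow> \<not> affine_dependent S)"

definition gp_sets :: "nat \<Rightarrow> (real ^ 'd) set set" where
  "gp_sets n = {X. finite X \<and> card X = n \<and> general_position X}"

text \<open>All maxima and minima below are taken over nonempty bounded, hence finite, sets of natural
  numbers, provided that \<open>X\<close> is finite. The ambient dimension is a type argument, so that
  \<open>r_min TYPE('d) n\<close> stands for $r(n,d)$ with \<open>d = CARD('d)\<close>.\<close>

definition radon_count :: "(real ^ 'd) set \<Rightarrow> (real ^ 'd) set \<Rightarrow> (real ^ 'd) set \<Rightarrow> nat" where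
  "radon_count X A B =
     card {S. S \<subseteq> X \<and> card S = CARD('d) + 2 \<and>
              convex hull (A \<inter> S) \<inter> convex hull (B \<inter> S) \<noteq> {}}"

definition r_max :: "(real ^ 'd) set \<Rightarrow> nat" where
  "r_max X = Max {radon_count X A B | A B. X = A \<union> B \<and> A \<inter> B = {}}"

definition r_min :: "'d::finite itself \<Rightarrow> nat \<Rightarrow> nat" where
  "r_min _ n = Min {r_max X | X :: (real ^ 'd) set. X \<in> gp_sets n}"

definition projective_map ::
  "(real ^ 'd \<Rightarrow> real ^ 'd) \<Rightarrow> real ^ 'd \<Rightarrow> real ^ 'd \<Rightarrow> real \<Rightarrow> real ^ 'd \<Rightarrow> real ^ 'd" where
  "projective_map A b c \<delta> x = (A x + b) /\<^sub>R (c \<bullet> x + \<delta>)"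

definition permissible :: "real ^ 'd \<Rightarrow> real \<Rightarrow> (real ^ 'd) set \<Rightarrow> bool" where
  "permissible c \<delta> X \<longleftrightarrow> (\<forall>x\<in>X. c \<bullet> x + \<delta> \<noteq> 0)"

definition num_faces :: "nat \<Rightarrow> (real ^ 'd) set \<Rightarrow> nat" where
  "num_faces k P = card {F. F face_of P \<and> aff_dim F = int k}"

text \<open>The maximum ranges over all coefficients \<open>A\<close>, \<open>b\<close>, \<open>c\<close>, \<open>\<delta>\<close>;
  non-singularity of the transformation is not required.\<close>

definition h_max :: "nat \<Rightarrow> (real ^ 'd) set \<Rightarrow> nat" where
  "h_max k X =
     Max {num_faces k (convex hull (projective_map A b c \<delta> ` X)) | A b c \<delta>.
            linear A \<and> (c \<noteq> 0 \<or> \<delta> \<noteq> 0) \<and> permissible c \<delta> X}"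

definition H_min :: "nat \<Rightarrow> 'd::finite itself \<Rightarrow> nat \<Rightarrow> nat" where
  "H_min k _ n = Min {h_max k X | X :: (real ^ 'd) set. X \<in> gp_sets n}"

end

theory Submission
  imports Defs
begin

text \<open>The bridge is Gale duality. To \<open>n = d + e + 2\<close> points \<open>x i\<close> in general position in dimension \<open>d\<close>
  belong \<open>n\<close> points \<open>y i\<close> in general position in dimension \<open>e\<close> and nonzero weights \<open>w i\<close> such that the
  affine relations of the family \<open>x\<close> are the functions \<open>w i * \<phi> (y i)\<close> with \<open>\<phi>\<close> affine
  (\<open>ex_gale_dual\<close>).

  A set \<open>S\<close> of \<open>d + 2\<close> of the points \<open>x i\<close> carries just one affine relation up to a factor, and the
  hulls of \<open>A \<inter> S\<close> and \<open>B \<inter> S\<close> meet if and only if this relation or its negative is positive on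
  \<open>A \<inter> S\<close> and negative on \<open>B \<inter> S\<close>. The relation comes from an affine function \<open>\<phi>\<close> vanishing at the
  \<open>e\<close> points \<open>y i\<close> complementary to \<open>S\<close>. So Radon partitions correspond to hyperplanes through \<open>e\<close>
  of the points \<open>y i\<close> that have each other point on a side prescribed by a sign
  (\<open>card_circuits_eq_card_cofacets\<close>); a partition into \<open>A\<close> and \<open>B\<close> amounts to a choice of signs.

  On the other side, dividing by an affine function \<open>\<psi>\<close> is what a projective map does to affine
  functions: a hyperplane supports the image of the points \<open>y i\<close> if and only if its preimage is
  given by an affine \<open>\<phi>\<close> for which \<open>\<phi> / \<psi>\<close> does not change sign on the points. Thus the facets of the
  image are counted by the same hyperplanes, the prescribed signs being those of \<open>\<psi>\<close>
  (\<open>num_faces_le_card_cofacets\<close>, \<open>card_cofacets_le_num_faces\<close>). A singular map has an image of lower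
  dimension, with at most one face of dimension \<open>e - 1\<close>, and does not affect the maximum.
  Sign patterns that are not those of any affine \<open>\<psi>\<close> admit no such hyperplane at all
  (\<open>ex_affine_with_signs\<close>).

  Hence dual families have equal invariants (\<open>r_max_eq_h_max_if_gale_dual\<close>). As the duality relation
  is symmetric and each family on either side has a dual, the two minima are taken over the same
  set of numbers.\<close>

section \<open>Labelled point sets in general position\<close>

text \<open>Labelling both a point set and its dual by one finite type \<open>'i\<close> lets the complement of a label
  set stand for the passage between \<open>d + 2\<close> points on one side and \<open>e\<close> points on the other.\<close>

definition gp_family :: "('i::finite \<Rightarrow> real ^ 'd) \<Rightarrow> bool" where
  "gp_family x \<longleftrightarrow> inj x \<and> general_position (range x)"

definition affine_relation :: "('i::finite \<Rightarrow> real) \<Rightarrow> ('i \<Rightarrow> real ^ 'd) \<Rightarrow> bool" where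
  "affine_relation l x \<longleftrightarrow> (\<Sum>i\<in>UNIV. l i) = 0 \<and> (\<Sum>i\<in>UNIV. l i *\<^sub>R x i) = 0"

lemma affine_relation_diff_scale:
  assumes "affine_relation l x" "affine_relation m x"
  shows "affine_relation (\<lambda>i. m i - t * l i) x"
  using assms unfolding affine_relation_def
  by (simp add: sum_subtractf algebra_simps flip: sum_distrib_left scaleR_scaleR scaleR_sum_right)

lemma affine_relation_affine_sum:
  assumes "affine_relation l x"
  shows "(\<Sum>i\<in>UNIV. l i * (a \<bullet> x i + \<alpha>)) = 0"
proof -
  have "(\<Sum>i\<in>UNIV. l i * (a \<bullet> x i + \<alpha>)) = a \<bullet> (\<Sum>i\<in>UNIV. l i *\<^sub>R x i) + (\<Sum>i\<in>UNIV. l i) * \<alpha>"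
    by (simp add: algebra_simps sum.distrib inner_sum_right sum_distrib_left)
  then show ?thesis using assms by (simp add: affine_relation_def)
qed

lemma affine_relation_if_affine_sums_zero:
  fixes x :: "'i::finite \<Rightarrow> real ^ 'd"
  assumes "\<And>a \<alpha>. (\<Sum>i\<in>UNIV. l i * (a \<bullet> x i + \<alpha>)) = 0"
  shows "affine_relation l x"
proof -
  have "(\<Sum>i\<in>UNIV. l i) = 0" using assms[of 0 1] by simp
  moreover have "a \<bullet> (\<Sum>i\<in>UNIV. l i *\<^sub>R x i) = 0" for a
    using assms[of a 0] by (simp add: inner_sum_right)
  then have "(\<Sum>i\<in>UNIV. l i *\<^sub>R x i) = 0" by (metis inner_eq_zero_iff)
  ultimately show ?thesis by (simp add: affine_relation_def)
qed

lemma gp_family_affine_independent: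
  fixes x :: "'i::finite \<Rightarrow> real ^ 'd"
  assumes "gp_family x" "card K \<le> CARD('d) + 1"
  shows "\<not> affine_dependent (x ` K)"
  using assms unfolding gp_family_def general_position_def
  by (metis card_image finite finite_imageI image_mono inj_on_subset subset_UNIV)

lemma gp_family_aff_dim:
  fixes x :: "'i::finite \<Rightarrow> real ^ 'd"
  assumes "gp_family x" "card K \<le> CARD('d) + 1"
  shows "aff_dim (x ` K) = int (card K) - 1"
proof -
  have "inj_on x K" using assms(1) by (auto simp: gp_family_def inj_on_def)
  then show ?thesis
    using gp_family_affine_independent[OF assms] by (simp add: affine_independent_iff_card card_image)
qed

text \<open>This is affine independence of at most \<open>d + 1\<close> points, transported from the set of points to
  their labels.\<close>

lemma gp_family_relation_zero:
  fixes x :: "'i::finite \<Rightarrow> real ^ 'd"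
  assumes gp: "gp_family x" and K: "card K \<le> CARD('d) + 1"
    and l: "affine_relation l x" and supp: "\<And>i. i \<notin> K \<Longrightarrow> l i = 0"
  shows "l i = 0"
proof (rule ccontr)
  assume "l i \<noteq> 0"
  have inj: "inj_on x K" using gp by (auto simp: gp_family_def inj_on_def)
  have inv: "inv x (x j) = j" for j using gp by (simp add: gp_family_def)
  have "(\<Sum>j\<in>K. l j) = (\<Sum>j\<in>UNIV. l j)" "(\<Sum>j\<in>K. l j *\<^sub>R x j) = (\<Sum>j\<in>UNIV. l j *\<^sub>R x j)"
    by (rule sum.mono_neutral_left; auto simp: supp)+
  then have "sum (l \<circ> inv x) (x ` K) = 0" "(\<Sum>v\<in>x ` K. (l \<circ> inv x) v *\<^sub>R v) = 0"
    using l by (simp_all add: affine_relation_def sum.reindex[OF inj] inv)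
  moreover have "x i \<in> x ` K" "(l \<circ> inv x) (x i) \<noteq> 0"
    using \<open>l i \<noteq> 0\<close> supp by (auto simp: inv)
  ultimately have "affine_dependent (x ` K)"
    unfolding affine_dependent_explicit_finite[OF finite_imageI[OF finite]] by blast
  then show False using gp_family_affine_independent[OF gp K] by simp
qed

lemma gp_family_hyperplane_card:
  fixes y :: "'i::finite \<Rightarrow> real ^ 'e"
  assumes gp: "gp_family y" and nz: "b \<noteq> 0 \<or> \<beta> \<noteq> 0" and J: "\<And>i. i \<in> J \<Longrightarrow> b \<bullet> y i + \<beta> = 0"
  shows "card J \<le> CARD('e)"
proof (rule ccontr)
  assume "\<not> card J \<le> CARD('e)"
  then obtain K where K: "K \<subseteq> J" "card K = CARD('e) + 1"
    by (metis Suc_eq_plus1 not_less_eq_eq obtain_subset_with_card_n)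
  then obtain k where "k \<in> K" by fastforce
  with K J[of k] nz have "b \<noteq> 0" by auto
  have "y ` K \<subseteq> {z. b \<bullet> z = - \<beta>}"
    using K J by (force simp: eq_neg_iff_add_eq_0)
  then have "aff_dim (y ` K) \<le> aff_dim {z. b \<bullet> z = - \<beta>}" by (rule aff_dim_subset)
  then show False
    using gp_family_aff_dim[OF gp, of K] K \<open>b \<noteq> 0\<close> by simp
qed

text \<open>Counting dimensions: \<open>e\<close> points have an affine hull of dimension less than \<open>e\<close>; general
  position then keeps every other point off the hyperplane.\<close>

lemma gp_family_hyperplane_through:
  fixes y :: "'i::finite \<Rightarrow> real ^ 'e"
  assumes gp: "gp_family y" and J: "card J = CARD('e)"
  obtains b \<beta> where "\<And>i. b \<bullet> y i + \<beta> = 0 \<longleftrightarrow> i \<in> J"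
proof -
  have "aff_dim (y ` J) < DIM(real ^ 'e)"
    using gp_family_aff_dim[OF gp, of J] J by simp
  then obtain b c where b: "b \<noteq> 0" "y ` J \<subseteq> {z. b \<bullet> z = c}"
    by (rule aff_lowdim_subset_hyperplane)
  have "b \<bullet> y i + - c \<noteq> 0" if "i \<notin> J" for i
  proof
    assume "b \<bullet> y i + - c = 0"
    then have "card (insert i J) \<le> CARD('e)"
      using b by (intro gp_family_hyperplane_card[OF gp, of b "- c"]) auto
    then show False using J that by simp
  qed
  with b show ?thesis by (intro that[of b "- c"]) auto
qed

text \<open>Over a family in general position, a relation supported on \<open>d + 2\<close> points is determined up to
  a factor: subtracting a multiple so as to kill one coefficient leaves a relation on \<open>d + 1\<close> points.\<close>

lemma gp_family_relation_unique:
  fixes x :: "'i::finite \<Rightarrow> real ^ 'd"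
  assumes gp: "gp_family x" and S: "card S = CARD('d) + 2"
    and l: "affine_relation l x" "\<And>i. i \<in> S \<longleftrightarrow> l i \<noteq> 0"
    and m: "affine_relation m x" "\<And>i. i \<notin> S \<Longrightarrow> m i = 0"
  obtains t where "\<And>i. m i = t * l i"
proof -
  obtain j where j: "j \<in> S" using S by fastforce
  define t where "t = m j / l j"
  have "m i - t * l i = 0" for i
  proof (rule gp_family_relation_zero[OF gp, of "S - {j}"])
    show "card (S - {j}) \<le> CARD('d) + 1" using S j by simp
    show "affine_relation (\<lambda>i. m i - t * l i) x" by (rule affine_relation_diff_scale[OF l(1) m(1)])
    show "m i - t * l i = 0" if "i \<notin> S - {j}" for i
      using that l(2)[of i] l(2)[of j] m(2)[of i] j by (auto simp: t_def)
  qed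
  then show ?thesis by (intro that[of t]) simp
qed

section \<open>Gale duality\<close>

lemma card_Compl_plus_card:
  fixes J :: "'i::finite set"
  shows "card (- J) + card J = CARD('i)"
  using card_Un_disjoint[of "- J" J] by simp

text \<open>With \<open>x i\<close> and \<open>y i\<close> extended by a coordinate 1, this says that the row spaces of the two
  matrices are orthogonal with respect to the weights \<open>w\<close>. If both families affinely span their
  spaces and \<open>n = d + e + 2\<close>, the dimensions complement each other, and each row space is, up to the
  weights, the space of relations of the other family. In this form the symmetry is evident.\<close>

definition gale_dual :: "('i::finite \<Rightarrow> real) \<Rightarrow> ('i \<Rightarrow> real ^ 'd) \<Rightarrow> ('i \<Rightarrow> real ^ 'e) \<Rightarrow> bool" where
  "gale_dual w x y \<longleftrightarrow> (\<forall>i. w i \<noteq> 0) \<and>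
     (\<forall>a \<alpha> b \<beta>. (\<Sum>i\<in>UNIV. w i * (a \<bullet> x i + \<alpha>) * (b \<bullet> y i + \<beta>)) = 0)"

lemma gale_dual_sym: "gale_dual w x y \<Longrightarrow> gale_dual w y x"
proof -
  assume "gale_dual w x y"
  moreover have "(\<Sum>i\<in>UNIV. w i * (b \<bullet> y i + \<beta>) * (a \<bullet> x i + \<alpha>))
      = (\<Sum>i\<in>UNIV. w i * (a \<bullet> x i + \<alpha>) * (b \<bullet> y i + \<beta>))" for a \<alpha> b \<beta>
    by (rule sum.cong) simp_all
  ultimately show "gale_dual w y x" by (simp add: gale_dual_def)
qed

lemma gale_dual_relation:
  assumes "gale_dual w x y"
  shows "affine_relation (\<lambda>i. w i * (b \<bullet> y i + \<beta>)) x"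
proof (rule affine_relation_if_affine_sums_zero)
  fix a \<alpha>
  have "(\<Sum>i\<in>UNIV. w i * (a \<bullet> x i + \<alpha>) * (b \<bullet> y i + \<beta>)) = 0"
    using assms by (simp add: gale_dual_def)
  then show "(\<Sum>i\<in>UNIV. w i * (b \<bullet> y i + \<beta>) * (a \<bullet> x i + \<alpha>)) = 0"
    by (simp add: mult.assoc mult.left_commute mult.commute)
qed

text \<open>A real vector space is not a finite union of proper subspaces, here of coordinate hyperplanes.\<close>

lemma ex_nowhere_zero_in_subspace:
  fixes D :: "(real ^ 'i::finite) set"
  assumes D: "subspace D" and ex: "\<And>i. \<exists>v\<in>D. v $ i \<noteq> 0"
  obtains w where "w \<in> D" "\<And>i. w $ i \<noteq> 0"
proof -
  have "\<exists>v\<in>D. \<forall>i\<in>K. v $ i \<noteq> 0" if "finite K" for K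
    using that
  proof induction
    case empty
    then show ?case using subspace_0[OF D] by auto
  next
    case (insert k K)
    then obtain v where v: "v \<in> D" "\<forall>i\<in>K. v $ i \<noteq> 0" by blast
    obtain u where u: "u \<in> D" "u $ k \<noteq> 0" using ex by blast
    \<comment> \<open>Each coordinate excludes at most one multiple of \<open>u\<close>.\<close>
    obtain t where t: "t \<notin> (\<lambda>i. - (v $ i / u $ i)) ` insert k K \<union> {0}"
      using ex_new_if_finite[OF infinite_UNIV_char_0, of "(\<lambda>i. - (v $ i / u $ i)) ` insert k K \<union> {0::real}"]
        insert.hyps by auto
    have "(v + t *\<^sub>R u) $ i \<noteq> 0" if "i \<in> insert k K" for i
    proof (cases "u $ i = 0")
      case True
      with that u v show ?thesis by auto
    next
      case False
      have "t \<noteq> - (v $ i / u $ i)" using t that by blast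
      with False show ?thesis
        by (simp add: field_simps eq_neg_iff_add_eq_0)
    qed
    moreover have "v + t *\<^sub>R u \<in> D" using u v D by (simp add: subspace_add subspace_scale)
    ultimately show ?case by blast
  qed
  from this[of UNIV] show ?thesis using that by auto
qed

text \<open>Any \<open>d + 1\<close> other points affinely span the space, so they express \<open>x k\<close>.\<close>

lemma gp_family_ex_relation_nonzero:
  fixes x :: "'i::finite \<Rightarrow> real ^ 'd"
  assumes gp: "gp_family x" and n: "CARD('i) \<ge> CARD('d) + 2"
  shows "\<exists>l. affine_relation l x \<and> l k \<noteq> 0"
proof -
  have "CARD('d) + 1 \<le> card (UNIV - {k})" using n by simp
  then obtain K where K: "K \<subseteq> UNIV - {k}" "card K = CARD('d) + 1"
    by (rule obtain_subset_with_card_n)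
  have inj: "inj_on x K" using gp by (auto simp: gp_family_def inj_on_def)
  have "aff_dim (x ` K) = DIM(real ^ 'd)" using gp_family_aff_dim[OF gp, of K] K by simp
  then have "x k \<in> affine hull (x ` K)" by (simp only: aff_dim_eq_full UNIV_I)
  then obtain u where u: "sum u (x ` K) = 1" "(\<Sum>v\<in>x ` K. u v *\<^sub>R v) = x k"
    by (auto simp: affine_hull_finite)
  define l where "l i = (if i \<in> K then u (x i) else 0) - (if i = k then 1 else 0)" for i
  have "(\<Sum>i\<in>UNIV. l i) = 0"
    using u by (simp add: l_def sum_subtractf sum.reindex[OF inj] sum.If_cases)
  moreover have "(\<Sum>i\<in>UNIV. l i *\<^sub>R x i) = (\<Sum>i\<in>UNIV. if i \<in> K then u (x i) *\<^sub>R x i else 0) - (\<Sum>i\<in>UNIV. if i = k then x i else 0)"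
    by (simp add: l_def scaleR_diff_left sum_subtractf if_distrib[of "\<lambda>c. c *\<^sub>R _"] cong: if_cong)
  moreover have "\<dots> = 0"
    using u by (simp add: sum.reindex[OF inj] sum.If_cases)
  ultimately have "affine_relation l x" by (simp add: affine_relation_def)
  moreover have "l k \<noteq> 0" using K by (auto simp: l_def)
  ultimately show ?thesis by blast
qed

text \<open>The relations are the vectors orthogonal to the \<open>d\<close> coordinate functions of the family and to the
  constant function 1.\<close>

lemma dim_affine_relations:
  fixes x :: "'i::finite \<Rightarrow> real ^ 'd"
  defines "D \<equiv> {l :: real ^ 'i. affine_relation (($) l) x}"
  shows "subspace D" "CARD('i) \<le> dim D + CARD('d) + 1"
proof -
  define R where "R = insert (\<chi> i. 1) (range (\<lambda>k. \<chi> i. x i $ k))"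
  have orth: "l \<in> D \<longleftrightarrow> (\<forall>r\<in>R. orthogonal r l)" for l
  proof -
    have "(\<Sum>i\<in>UNIV. l $ i *\<^sub>R x i) = 0 \<longleftrightarrow> (\<forall>k. (\<Sum>i\<in>UNIV. x i $ k * l $ i) = 0)"
      by (simp add: vec_eq_iff mult.commute)
    then show ?thesis
      by (simp add: D_def R_def affine_relation_def orthogonal_def inner_vec_def)
  qed
  have "l \<in> D \<longleftrightarrow> (\<forall>r\<in>span R. orthogonal r l)" for l
    unfolding orth by (meson orthogonal_to_span orthogonal_commute span_base)
  then have D: "D = {l \<in> UNIV. \<forall>r\<in>span R. orthogonal r l}" by blast
  show "subspace D"
    by (auto simp: D subspace_def orthogonal_clauses)
  have "dim D + dim (span R) = CARD('i)"
    using dim_subspace_orthogonal_to_vectors[of "span R" UNIV] by (simp add: D)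
  moreover have "dim (span R) \<le> card R" by (simp add: R_def dim_le_card')
  moreover have "card R \<le> CARD('d) + 1"
  proof -
    have "card (range (\<lambda>k. \<chi> i. x i $ k)) \<le> CARD('d)" by (rule card_image_le) simp
    then show ?thesis unfolding R_def
      using card_insert_le_m1[of "CARD('d) + 1" "range (\<lambda>k. \<chi> i. x i $ k)"] by simp
  qed
  ultimately show "CARD('i) \<le> dim D + CARD('d) + 1" by linarith
qed

text \<open>Points with the same position and affinely dependent points both lower the dimension of the
  affine hull, so \<open>e + 1\<close> labels that contain either would lie on a hyperplane.\<close>

lemma gp_familyI:
  fixes y :: "'i::finite \<Rightarrow> real ^ 'e"
  assumes n: "CARD('i) \<ge> CARD('e) + 1"
    and K: "\<And>K b \<beta>. card K = CARD('e) + 1 \<Longrightarrow> (\<And>i. i \<in> K \<Longrightarrow> b \<bullet> y i + \<beta> = 0) \<Longrightarrow> b = 0"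
  shows "gp_family y"
proof -
  have indep: "inj_on y K \<and> \<not> affine_dependent (y ` K)" if c: "card K = CARD('e) + 1" for K
  proof -
    have "\<not> aff_dim (y ` K) < int CARD('e)"
    proof
      assume "aff_dim (y ` K) < int CARD('e)"
      then have "aff_dim (y ` K) < DIM(real ^ 'e)" by simp
      then obtain b \<beta> where "b \<noteq> 0" "y ` K \<subseteq> {z. b \<bullet> z = \<beta>}"
        by (rule aff_lowdim_subset_hyperplane)
      with K[OF c, of b "- \<beta>"] show False by auto
    qed
    moreover have "aff_dim (y ` K) \<le> int (card (y ` K)) - 1" by (rule aff_dim_le_card) simp
    moreover have "card (y ` K) \<le> card K" by (simp add: card_image_le)
    ultimately have "card (y ` K) = card K" "aff_dim (y ` K) = int (card (y ` K)) - 1"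
      using c by linarith+
    then show ?thesis by (intro conjI eq_card_imp_inj_on) (simp_all add: affine_independent_iff_card)
  qed
  have extend: "\<exists>K'. K \<subseteq> K' \<and> card K' = CARD('e) + 1" if "card K \<le> CARD('e) + 1" for K :: "'i set"
    using exists_subset_between[OF that n] by auto
  have "inj y"
  proof (rule injI)
    fix i j assume eq: "y i = y j"
    have "card {i, j} \<le> CARD('e) + 1"
      using zero_less_card_finite[where 'a='e] by (simp add: card_insert_if)
    then obtain K' where K': "{i, j} \<subseteq> K'" "card K' = CARD('e) + 1" using extend by blast
    then show "i = j" using indep[of K'] eq by (auto simp: inj_on_def)
  qed
  moreover have "\<not> affine_dependent S" if S: "S \<subseteq> range y" "card S \<le> CARD('e) + 1" for S
  proof -
    obtain K where K: "S = y ` K" using S by (auto simp: subset_image_iff)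
    have "card K = card S" using K \<open>inj y\<close> by (simp add: card_image inj_on_subset)
    with S obtain K' where K': "K \<subseteq> K'" "card K' = CARD('e) + 1" using extend[of K] by auto
    with indep have "\<not> affine_dependent (y ` K')" by blast
    then show ?thesis using K K' by (meson affine_dependent_subset image_mono)
  qed
  ultimately show ?thesis by (simp add: gp_family_def general_position_def)
qed

text \<open>The relations of \<open>x\<close> form a space of dimension at least \<open>e + 1\<close>. Choose in it \<open>e + 1\<close> independent
  relations, one of which, \<open>w\<close>, vanishes nowhere; the quotients of the other ones by \<open>w\<close> are the
  coordinate functions of the dual family, so that the products of \<open>w\<close> with affine functions on the
  dual family are relations of \<open>x\<close>. An affine function vanishing on \<open>e + 1\<close> of the dual points gives a
  relation on \<open>d + 1\<close> points of \<open>x\<close>, which is trivial; hence the dual is in general position.\<close>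

lemma ex_gale_dual:
  fixes x :: "'i::finite \<Rightarrow> real ^ 'd"
  assumes gp: "gp_family x" and n: "CARD('i) = CARD('d) + CARD('e::finite) + 2"
  obtains w and y :: "'i \<Rightarrow> real ^ 'e" where "gale_dual w x y" "gp_family y"
proof -
  define D where "D = {l :: real ^ 'i. affine_relation (($) l) x}"
  have D: "subspace D" "CARD('e) + 1 \<le> dim D"
    using dim_affine_relations[of x] n unfolding D_def by auto
  have "\<exists>l\<in>D. l $ k \<noteq> 0" for k
  proof -
    obtain l where l: "affine_relation l x" "l k \<noteq> 0"
      using gp_family_ex_relation_nonzero[OF gp] n by auto
    then have "(\<chi> i. l i) \<in> D" by (simp add: D_def affine_relation_def)
    with l(2) show ?thesis by (intro bexI[of _ "\<chi> i. l i"]) simp_all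
  qed
  then obtain w where w: "w \<in> D" "\<And>i. w $ i \<noteq> 0"
    using ex_nowhere_zero_in_subspace[OF D(1)] by blast
  have "w \<noteq> 0" using w(2) by auto
  then have "independent {w}" by simp
  with w obtain B where B: "{w} \<subseteq> B" "B \<subseteq> D" "independent B" "D \<subseteq> span B"
    using maximal_independent_subset_extend[of "{w}" D] by auto
  have finB: "finite B" using B(3) by (rule independent_imp_finite)
  have "card B = dim D" using B by (intro basis_card_eq_dim) auto
  then have "CARD('e) \<le> card (B - {w})" using D(2) B(1) by simp
  then obtain E where E: "E \<subseteq> B - {w}" "card E = CARD('e)" "finite E"
    by (rule obtain_subset_with_card_n)
  then obtain g where g: "bij_betw g (UNIV :: 'e set) E"
    using finite_same_card_bij[of "UNIV :: 'e set" E] by auto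
  then have ginj: "inj g" and grange: "range g = E" by (auto simp: bij_betw_def)
  define y where "y i = (\<chi> k. g k $ i / w $ i)" for i
  define L where "L b \<beta> = (\<Sum>k\<in>UNIV. b $ k *\<^sub>R g k) + \<beta> *\<^sub>R w" for b :: "real ^ 'e" and \<beta>
  have L: "L b \<beta> $ i = w $ i * (b \<bullet> y i + \<beta>)" for b \<beta> i
    using w(2)[of i] by (simp add: L_def y_def inner_vec_def algebra_simps sum_distrib_left)
  have g_in: "g k \<in> D" for k using grange E B by blast
  have LD: "L b \<beta> \<in> D" for b \<beta>
    unfolding L_def using D(1) w g_in by (intro subspace_add subspace_sum subspace_scale) auto
  have L_zero: "b = 0" if "L b \<beta> = 0" for b \<beta>
  proof -
    define u where "u v = (if v = w then \<beta> else b $ inv g v)" for v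
    have "w \<notin> E" using E by auto
    then have gw: "g k \<noteq> w" for k using grange by blast
    have "(\<Sum>v\<in>insert w E. u v *\<^sub>R v) = \<beta> *\<^sub>R w + (\<Sum>v\<in>range g. u v *\<^sub>R v)"
      using \<open>w \<notin> E\<close> E(3) by (simp add: u_def grange)
    also have "\<dots> = L b \<beta>"
      by (simp add: sum.reindex[OF ginj] u_def gw ginj L_def add.commute)
    finally have sum0: "(\<Sum>v\<in>insert w E. u v *\<^sub>R v) = 0" using that by simp
    have "u (g k) = 0" for k
      by (rule independentD[OF B(3) _ _ sum0]) (use E B grange in auto)
    then have "b $ k = 0" for k using gw[of k] ginj by (metis inv_f_f u_def)
    then show "b = 0" by (simp add: vec_eq_iff)
  qed
  have "gale_dual (($) w) x y"
  proof -
    have "(\<Sum>i\<in>UNIV. L b \<beta> $ i * (a \<bullet> x i + \<alpha>)) = 0" for a \<alpha> b \<beta>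
      using LD[of b \<beta>] unfolding D_def by (intro affine_relation_affine_sum) simp
    then show ?thesis unfolding gale_dual_def L using w(2) by (simp add: mult_ac)
  qed
  moreover have "gp_family y"
  proof (rule gp_familyI)
    show "CARD('i) \<ge> CARD('e) + 1" using n by simp
  next
    fix K b \<beta> assume K: "card K = CARD('e) + 1" "\<And>i. i \<in> K \<Longrightarrow> b \<bullet> y i + \<beta> = 0"
    have "L b \<beta> $ i = 0" for i
    proof (rule gp_family_relation_zero[OF gp, of "- K"])
      show "card (- K) \<le> CARD('d) + 1" using K(1) n card_Compl_plus_card[of K] by simp
      show "affine_relation (($) (L b \<beta>)) x" using LD by (simp add: D_def)
      show "L b \<beta> $ i = 0" if "i \<notin> - K" for i using K(2) that by (simp add: L)
    qed
    then show "b = 0" by (intro L_zero[of b \<beta>]) (simp add: vec_eq_iff)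
  qed
  ultimately show ?thesis by (rule that)
qed

text \<open>The label sets of the \<open>d + 2\<close> points whose Radon partition agrees with the signs of \<open>s\<close>.\<close>

definition circuits :: "('i::finite \<Rightarrow> real) \<Rightarrow> ('i \<Rightarrow> real ^ 'd) \<Rightarrow> 'i set set" where
  "circuits s x = {S. card S = CARD('d) + 2 \<and>
     (\<exists>l. affine_relation l x \<and> (\<forall>i\<in>-S. l i = 0) \<and> (\<forall>i\<in>S. s i * l i > 0))}"

text \<open>If \<open>s\<close> is constantly 1, these are the vertex sets of the facets of the convex hull of a family in
  general position. For general nonzero signs \<open>s\<close> they are the facets of the cone spanned by the vectors
  \<open>s i *\<^sub>R (y i, 1)\<close>.\<close>

definition cofacets :: "('i::finite \<Rightarrow> real) \<Rightarrow> ('i \<Rightarrow> real ^ 'e) \<Rightarrow> 'i set set" where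
  "cofacets s y = {J. card J = CARD('e) \<and>
     (\<exists>b \<beta>. (\<forall>i\<in>J. b \<bullet> y i + \<beta> = 0) \<and> (\<forall>i\<in>-J. s i * (b \<bullet> y i + \<beta>) > 0))}"

text \<open>The correspondence is complementation of label sets: an affine function vanishing on \<open>J\<close> gives,
  after multiplication by the weights, a relation supported on the complement of \<open>J\<close>.\<close>

lemma card_circuits_eq_card_cofacets:
  fixes x :: "'i::finite \<Rightarrow> real ^ 'd" and y :: "'i \<Rightarrow> real ^ 'e"
  assumes dual: "gale_dual w x y" and gpx: "gp_family x" and gpy: "gp_family y"
    and n: "CARD('i) = CARD('d) + CARD('e) + 2"
  shows "card (circuits s x) = card (cofacets (\<lambda>i. s i * w i) y)"
proof -
  have iff: "- J \<in> circuits s x \<longleftrightarrow> J \<in> cofacets (\<lambda>i. s i * w i) y" for J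
  proof
    assume "J \<in> cofacets (\<lambda>i. s i * w i) y"
    then obtain b \<beta> where J: "card J = CARD('e)" "\<forall>i\<in>J. b \<bullet> y i + \<beta> = 0"
      "\<forall>i\<in>-J. s i * w i * (b \<bullet> y i + \<beta>) > 0"
      by (auto simp: cofacets_def)
    moreover have "card (- J) = CARD('d) + 2" using J(1) n card_Compl_plus_card[of J] by simp
    ultimately show "- J \<in> circuits s x"
      unfolding circuits_def using gale_dual_relation[OF dual, of b \<beta>]
      by (auto intro!: exI[of _ "\<lambda>i. w i * (b \<bullet> y i + \<beta>)"] simp: mult.assoc)
  next
    assume "- J \<in> circuits s x"
    then obtain l where c: "card (- J) = CARD('d) + 2" and l: "affine_relation l x"
      "\<forall>i\<in>J. l i = 0" "\<forall>i\<in>-J. s i * l i > 0"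
      by (auto simp: circuits_def)
    have J: "card J = CARD('e)" using c n card_Compl_plus_card[of J] by simp
    obtain b \<beta> where b: "\<And>i. b \<bullet> y i + \<beta> = 0 \<longleftrightarrow> i \<in> J"
      using gp_family_hyperplane_through[OF gpy J] by blast
    \<comment> \<open>The hyperplane through \<open>J\<close> induces a relation on the same points as \<open>l\<close>, hence a multiple of \<open>l\<close>.\<close>
    obtain t where t: "\<And>i. l i = t * (w i * (b \<bullet> y i + \<beta>))"
    proof (rule gp_family_relation_unique[OF gpx c gale_dual_relation[OF dual, of b \<beta>] _ l(1)])
      show "i \<in> - J \<longleftrightarrow> w i * (b \<bullet> y i + \<beta>) \<noteq> 0" for i
        using dual b[of i] by (simp add: gale_dual_def)
    qed (use l in auto)
    have "(t *\<^sub>R b) \<bullet> y i + t * \<beta> = t * (b \<bullet> y i + \<beta>)" for i by (simp add: algebra_simps)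
    then have "(\<forall>i\<in>J. (t *\<^sub>R b) \<bullet> y i + t * \<beta> = 0)"
      "\<forall>i\<in>-J. s i * w i * ((t *\<^sub>R b) \<bullet> y i + t * \<beta>) > 0"
      using b l(3) t by (auto simp: mult_ac)
    with J show "J \<in> cofacets (\<lambda>i. s i * w i) y" unfolding cofacets_def by blast
  qed
  have "bij_betw uminus (cofacets (\<lambda>i. s i * w i) y) (circuits s x)"
  proof (rule bij_betwI[where g = uminus])
    show "uminus \<in> cofacets (\<lambda>i. s i * w i) y \<rightarrow> circuits s x" using iff by blast
    show "uminus \<in> circuits s x \<rightarrow> cofacets (\<lambda>i. s i * w i) y"
    proof
      fix S assume "S \<in> circuits s x"
      then show "- S \<in> cofacets (\<lambda>i. s i * w i) y" using iff[of "- S"] by simp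
    qed
  qed auto
  then show ?thesis by (simp add: bij_betw_same_card)
qed

section \<open>Radon partitions\<close>

lemma circuits_sign_cong:
  assumes "\<And>i. s i > 0 \<longleftrightarrow> s' i > 0" "\<And>i. s i < 0 \<longleftrightarrow> s' i < 0"
  shows "circuits s x = circuits s' x"
  using assms by (simp add: circuits_def zero_less_mult_iff)

text \<open>A common point of the two hulls is a pair of convex combinations with equal value; their
  difference is a relation with the required signs. Conversely, the positive and the negative part
  of a relation have equal total weight, and normalizing them gives the common point.\<close>

lemma radon_count_eq_card_circuits:
  fixes x :: "'i::finite \<Rightarrow> real ^ 'd"
  assumes gp: "gp_family x" and AB: "range x = A \<union> B" "A \<inter> B = {}"
  shows "radon_count (range x) A B = card (circuits (\<lambda>i. if x i \<in> A then 1 else - 1) x)"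
proof -
  define s :: "'i \<Rightarrow> real" where "s = (\<lambda>i. if x i \<in> A then 1 else - 1)"
  have inj: "inj x" using gp by (simp add: gp_family_def)
  have iff: "(convex hull (A \<inter> x ` K) \<inter> convex hull (B \<inter> x ` K) \<noteq> {}) \<longleftrightarrow> K \<in> circuits s x"
    if c: "card K = CARD('d) + 2" for K
  proof -
    define KA where "KA = {i \<in> K. x i \<in> A}"
    define KB where "KB = {i \<in> K. x i \<notin> A}"
    have AK: "A \<inter> x ` K = x ` KA" and BK: "B \<inter> x ` K = x ` KB"
      using AB by (auto simp: KA_def KB_def)
    have part: "K = KA \<union> KB" "KA \<inter> KB = {}" by (auto simp: KA_def KB_def)
    have injA: "inj_on x KA" "inj_on x KB" using inj by (auto intro: inj_on_subset)
    show ?thesis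
    proof
      assume "convex hull (A \<inter> x ` K) \<inter> convex hull (B \<inter> x ` K) \<noteq> {}"
      then obtain z where z: "z \<in> convex hull (x ` KA)" "z \<in> convex hull (x ` KB)"
        by (auto simp: AK BK)
      obtain u where u: "\<And>i. i \<in> KA \<Longrightarrow> 0 \<le> u (x i)" "(\<Sum>i\<in>KA. u (x i)) = 1"
        "(\<Sum>i\<in>KA. u (x i) *\<^sub>R x i) = z"
        using z(1) by (auto simp: convex_hull_finite sum.reindex[OF injA(1)])
      obtain v where v: "\<And>i. i \<in> KB \<Longrightarrow> 0 \<le> v (x i)" "(\<Sum>i\<in>KB. v (x i)) = 1"
        "(\<Sum>i\<in>KB. v (x i) *\<^sub>R x i) = z"
        using z(2) by (auto simp: convex_hull_finite sum.reindex[OF injA(2)])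
      define l where "l i = (if i \<in> KA then u (x i) else 0) - (if i \<in> KB then v (x i) else 0)" for i
      have "(\<Sum>i\<in>UNIV. l i) = 0" using u v by (simp add: l_def sum_subtractf sum.If_cases)
      moreover have "(\<Sum>i\<in>UNIV. l i *\<^sub>R x i) =
          (\<Sum>i\<in>UNIV. if i \<in> KA then u (x i) *\<^sub>R x i else 0) - (\<Sum>i\<in>UNIV. if i \<in> KB then v (x i) *\<^sub>R x i else 0)"
        by (simp add: l_def scaleR_diff_left sum_subtractf if_distrib[of "\<lambda>c. c *\<^sub>R _"] cong: if_cong)
      moreover have "\<dots> = 0" using u v by (simp add: sum.If_cases)
      ultimately have l: "affine_relation l x" by (simp add: affine_relation_def)
      have supp: "l i = 0" if "i \<notin> K" for i using that part by (auto simp: l_def)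
      have nonneg: "s i * l i \<ge> 0" if "i \<in> K" for i
        using that u(1)[of i] v(1)[of i] by (auto simp: s_def l_def KA_def KB_def)
      \<comment> \<open>In general position a vanishing coefficient would leave a relation on \<open>d + 1\<close> points.\<close>
      have "l i \<noteq> 0" if i: "i \<in> K" for i
      proof
        assume "l i = 0"
        then have l0: "l j = 0" for j
          using gp_family_relation_zero[OF gp, of "K - {i}" l] c i l supp by auto
        then have "u (x j) = 0" if "j \<in> KA" for j
          using that part(2) l0[of j] by (auto simp: l_def)
        with u(2) show False by simp
      qed
      moreover have "s i \<noteq> 0" for i by (simp add: s_def)
      ultimately have "\<forall>i\<in>K. s i * l i > 0" using nonneg by (simp add: less_le)
      with c l supp show "K \<in> circuits s x" unfolding circuits_def by auto
    next
      assume "K \<in> circuits s x"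
      then obtain l where l: "affine_relation l x" "\<And>i. i \<notin> K \<Longrightarrow> l i = 0" "\<And>i. i \<in> K \<Longrightarrow> s i * l i > 0"
        by (auto simp: circuits_def)
      have posA: "l i > 0" if "i \<in> KA" for i using l(3)[of i] that by (simp add: s_def KA_def)
      have negB: "l i < 0" if "i \<in> KB" for i using l(3)[of i] that by (simp add: s_def KB_def)
      have "(\<Sum>i\<in>K. l i) = (\<Sum>i\<in>UNIV. l i)" "(\<Sum>i\<in>K. l i *\<^sub>R x i) = (\<Sum>i\<in>UNIV. l i *\<^sub>R x i)"
        by (rule sum.mono_neutral_left; auto simp: l(2))+
      then have sums: "(\<Sum>i\<in>KA. l i) + (\<Sum>i\<in>KB. l i) = 0"
        "(\<Sum>i\<in>KA. l i *\<^sub>R x i) + (\<Sum>i\<in>KB. l i *\<^sub>R x i) = 0"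
        using l(1) part by (simp_all add: affine_relation_def sum.union_disjoint)
      define p where "p = (\<Sum>i\<in>KA. l i)"
      have "p \<noteq> 0"
      proof
        assume "p = 0"
        then have "KA = {}" unfolding p_def using posA by (metis finite less_irrefl sum_pos)
        moreover have "(\<Sum>i\<in>KB. - l i) = 0" using sums \<open>p = 0\<close> by (simp add: p_def sum_negf)
        then have "KB = {}" using negB by (metis finite less_irrefl neg_0_less_iff_less sum_pos)
        ultimately show False using part c by simp
      qed
      moreover have "p \<ge> 0" unfolding p_def using posA by (intro sum_nonneg) (auto intro: less_imp_le)
      ultimately have p: "p > 0" by simp
      have pB: "(\<Sum>i\<in>KB. l i) = - p" using sums by (simp add: p_def)
      define z where "z = (\<Sum>i\<in>KA. (l i / p) *\<^sub>R x i)"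
      have zB: "z = (\<Sum>i\<in>KB. (- l i / p) *\<^sub>R x i)"
      proof -
        have "z = (1 / p) *\<^sub>R (\<Sum>i\<in>KA. l i *\<^sub>R x i)" by (simp add: z_def scaleR_sum_right)
        also have "\<dots> = (- 1 / p) *\<^sub>R (\<Sum>i\<in>KB. l i *\<^sub>R x i)"
          using sums(2) by (simp add: eq_neg_iff_add_eq_0[symmetric])
        finally show ?thesis by (simp add: scaleR_sum_right)
      qed
      have "z \<in> convex hull (x ` KA)" unfolding z_def
        using p posA by (intro convex_sum)
          (auto simp: hull_inc less_imp_le p_def simp flip: sum_divide_distrib)
      moreover have "z \<in> convex hull (x ` KB)" unfolding zB
        using p negB pB by (intro convex_sum)
          (auto simp: hull_inc less_imp_le divide_nonpos_pos sum_negf simp flip: sum_divide_distrib)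
      ultimately show "convex hull (A \<inter> x ` K) \<inter> convex hull (B \<inter> x ` K) \<noteq> {}"
        by (auto simp: AK BK)
    qed
  qed
  have "{S. S \<subseteq> range x \<and> card S = CARD('d) + 2 \<and> convex hull (A \<inter> S) \<inter> convex hull (B \<inter> S) \<noteq> {}}
      = image x ` circuits s x" (is "?L = _")
  proof
    show "?L \<subseteq> image x ` circuits s x"
    proof
      fix S assume S: "S \<in> ?L"
      then obtain K where K: "S = x ` K" by (auto simp: subset_image_iff)
      with S inj have "card K = CARD('d) + 2" by (simp add: card_image inj_on_subset)
      with iff[of K] S K show "S \<in> image x ` circuits s x" by blast
    qed
    show "image x ` circuits s x \<subseteq> ?L"
    proof
      fix S assume "S \<in> image x ` circuits s x"
      then obtain K where K: "S = x ` K" "K \<in> circuits s x" by blast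
      then have "card K = CARD('d) + 2" by (simp add: circuits_def)
      with iff[of K] K inj show "S \<in> ?L" by (auto simp: card_image inj_on_subset)
    qed
  qed
  moreover have "inj_on (image x) (circuits s x)"
    using inj by (auto simp: inj_on_def inj_image_eq_iff)
  ultimately show ?thesis unfolding radon_count_def s_def by (simp add: card_image)
qed

section \<open>Facets of projective images\<close>

lemma cofacets_pos_cong:
  assumes "\<And>i. s i * s' i > 0"
  shows "cofacets s y = cofacets s' y"
proof -
  have "s i * t > 0 \<longleftrightarrow> s' i * t > 0" for i t
    using assms[of i] by (auto simp: zero_less_mult_iff)
  then show ?thesis by (simp add: cofacets_def)
qed

lemma ex_cofacets_nonempty:
  fixes y :: "'i::finite \<Rightarrow> real ^ 'e"
  assumes gp: "gp_family y" and n: "CARD('i) \<ge> CARD('e) + 1"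
  obtains s where "\<And>i. s i \<noteq> 0" "cofacets s y \<noteq> {}"
proof -
  obtain J :: "'i set" where J: "card J = CARD('e)"
    using n obtain_subset_with_card_n[of "CARD('e)" "UNIV :: 'i set"] by auto
  obtain b \<beta> where b: "\<And>i. b \<bullet> y i + \<beta> = 0 \<longleftrightarrow> i \<in> J"
    using gp_family_hyperplane_through[OF gp J] by blast
  define s where "s i = (if i \<in> J then 1 else b \<bullet> y i + \<beta>)" for i
  have "0 < s i * (b \<bullet> y i + \<beta>)" if "i \<notin> J" for i
    using that b[of i] by (simp add: s_def flip: power2_eq_square)
  then have "J \<in> cofacets s y" using J b unfolding cofacets_def by blast
  moreover have "s i \<noteq> 0" for i using b[of i] by (simp add: s_def)
  ultimately show ?thesis by (intro that[of s]) auto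
qed

lemma ex_positive_perturbation:
  fixes f g :: "'i::finite \<Rightarrow> real"
  assumes f: "\<And>i. f i \<ge> 0" and g: "\<And>i. f i = 0 \<Longrightarrow> g i > 0"
  obtains t where "t > 0" "\<And>i. f i + t * g i > 0"
proof -
  have "\<forall>\<^sub>F t in at_right 0. f i + t * g i > 0" for i
  proof (cases "f i = 0")
    case True
    have "\<forall>\<^sub>F t in at_right (0::real). 0 < t" by (rule eventually_at_right_less)
    then show ?thesis by eventually_elim (use True g[of i] in simp)
  next
    case False
    have "((\<lambda>t. f i + t * g i) \<longlongrightarrow> f i + 0 * g i) (at_right 0)" by (intro tendsto_intros)
    then show ?thesis using False f[of i] by (intro order_tendstoD) auto
  qed
  then have "\<forall>\<^sub>F t in at_right 0. \<forall>i. f i + t * g i > 0" by (rule eventually_all_finite)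
  with eventually_at_right_less[of "0::real"] have "\<forall>\<^sub>F t in at_right 0. 0 < t \<and> (\<forall>i. f i + t * g i > 0)"
    by eventually_elim simp
  then have "\<exists>t>0. \<forall>i. f i + t * g i > 0"
    by (rule eventually_happens'[rotated]) simp
  then show ?thesis using that by blast
qed

text \<open>If some hyperplane through \<open>e\<close> points has all other points on the sides prescribed by \<open>s\<close>, a
  slight tilt gives those \<open>e\<close> points the prescribed signs, too. The correction used for the tilt is a
  sum of affine functions, each of which is nonzero at only one of the \<open>e\<close> points. A further
  perturbation makes the constant term nonzero, which is what makes the projective map whose
  numerator is the identity nonsingular.\<close>

lemma ex_affine_with_signs:
  fixes y :: "'i::finite \<Rightarrow> real ^ 'e"
  assumes gp: "gp_family y" and n: "CARD('i) \<ge> CARD('e) + 1"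
    and s: "\<And>i. s i \<noteq> 0" and ne: "cofacets s y \<noteq> {}"
  obtains c \<delta> where "\<delta> \<noteq> 0" "\<And>i. s i * (c \<bullet> y i + \<delta>) > 0"
proof -
  obtain J b \<beta> where J: "card J = CARD('e)" "\<And>i. i \<in> J \<Longrightarrow> b \<bullet> y i + \<beta> = 0"
    "\<And>i. i \<notin> J \<Longrightarrow> s i * (b \<bullet> y i + \<beta>) > 0"
    using ne unfolding cofacets_def by blast
  have "J \<noteq> UNIV" using J(1) n by auto
  then obtain k where k: "k \<notin> J" by blast
  have "\<exists>c \<gamma>. \<forall>i. c \<bullet> y i + \<gamma> = 0 \<longleftrightarrow> i \<in> insert k (J - {j})" if "j \<in> J" for j
  proof -
    have "card (insert k (J - {j})) = CARD('e)" using J(1) k that by (simp add: card_Suc_Diff1)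
    then show ?thesis by (metis gp_family_hyperplane_through[OF gp])
  qed
  then obtain C \<gamma> where C: "\<And>i j. j \<in> J \<Longrightarrow> C j \<bullet> y i + \<gamma> j = 0 \<longleftrightarrow> i \<in> insert k (J - {j})"
    by metis
  define t where "t j = s j * (C j \<bullet> y j + \<gamma> j)" for j
  define c' where "c' = (\<Sum>j\<in>J. t j *\<^sub>R C j)"
  define \<gamma>' where "\<gamma>' = (\<Sum>j\<in>J. t j * \<gamma> j)"
  have corr: "s m * (c' \<bullet> y m + \<gamma>') > 0" if m: "m \<in> J" for m
  proof -
    have "c' \<bullet> y m + \<gamma>' = (\<Sum>j\<in>J. t j * (C j \<bullet> y m + \<gamma> j))"
      by (simp add: c'_def \<gamma>'_def inner_sum_left sum.distrib algebra_simps)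
    also have "\<dots> = (\<Sum>j\<in>{m}. t j * (C j \<bullet> y m + \<gamma> j))"
      using m C by (intro sum.mono_neutral_right) auto
    finally have "s m * (c' \<bullet> y m + \<gamma>') = (s m * (C m \<bullet> y m + \<gamma> m))\<^sup>2"
      by (simp add: t_def power2_eq_square mult_ac)
    moreover have "m \<noteq> k" using m k by blast
    then have "s m * (C m \<bullet> y m + \<gamma> m) \<noteq> 0" using C[OF m, of m] s by simp
    ultimately show ?thesis by simp
  qed
  have "0 \<le> s i * (b \<bullet> y i + \<beta>)" for i using J(2,3)[of i] by (cases "i \<in> J") auto
  moreover have "s i * (c' \<bullet> y i + \<gamma>') > 0" if "s i * (b \<bullet> y i + \<beta>) = 0" for i
    using that corr[of i] J(3)[of i] by force
  ultimately obtain r where r: "\<And>i. s i * (b \<bullet> y i + \<beta>) + r * (s i * (c' \<bullet> y i + \<gamma>')) > 0"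
    using ex_positive_perturbation[of "\<lambda>i. s i * (b \<bullet> y i + \<beta>)" "\<lambda>i. s i * (c' \<bullet> y i + \<gamma>')"] by blast
  define c where "c = b + r *\<^sub>R c'"
  define \<delta> where "\<delta> = \<beta> + r * \<gamma>'"
  have pos: "s i * (c \<bullet> y i + \<delta>) > 0" for i
    using r[of i] by (simp add: c_def \<delta>_def algebra_simps)
  obtain q where q: "q > 0" "\<And>i. s i * (c \<bullet> y i + \<delta>) + q * s i > 0"
    using ex_positive_perturbation[of "\<lambda>i. s i * (c \<bullet> y i + \<delta>)" s] pos by (metis less_irrefl less_imp_le)
  show ?thesis
  proof (cases "\<delta> = 0")
    case True
    with q show ?thesis by (intro that[of q c]) (auto simp: algebra_simps)
  next
    case False
    with pos show ?thesis by (intro that)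
  qed
qed

lemma face_eq_hull_of_vertices:
  fixes z :: "'i::finite \<Rightarrow> real ^ 'e"
  assumes F: "F face_of convex hull range z"
  shows "F = convex hull (z ` {i. z i \<in> F})"
proof
  obtain V where V: "V \<subseteq> range z" "F = convex hull V"
    using face_of_convex_hull_subset[OF finite_imp_compact F] by auto
  then have "V \<subseteq> z ` {i. z i \<in> F}" using hull_subset[of V convex] by auto
  then show "F \<subseteq> convex hull (z ` {i. z i \<in> F})" using V(2) by (simp add: hull_mono)
  show "convex hull (z ` {i. z i \<in> F}) \<subseteq> F"
    using face_of_imp_convex[OF F] by (intro hull_minimal) auto
qed

lemma polytope_hull_range: "polytope (convex hull range (z :: 'i::finite \<Rightarrow> real ^ 'e))"
  by (simp add: polytope_convex_hull)

text \<open>Faces of dimension \<open>e - 1\<close> are facets unless the image is degenerate, in which case the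
  polytope itself is the only candidate. A facet is determined by the labels of the points on it;
  the pullback of its affine equation vanishes exactly at these, of which there are at least \<open>e\<close> by
  dimension and at most \<open>e\<close> by general position.\<close>

lemma num_faces_le_card_cofacets:
  fixes y :: "'i::finite \<Rightarrow> real ^ 'e"
  assumes gp: "gp_family y" and lin: "linear A" and perm: "\<And>i. c \<bullet> y i + \<delta> \<noteq> 0"
  shows "num_faces (CARD('e) - 1) (convex hull (projective_map A b c \<delta> ` range y))
           \<le> max 1 (card (cofacets (\<lambda>i. c \<bullet> y i + \<delta>) y))"
proof -
  define z where "z i = projective_map A b c \<delta> (y i)" for i
  define P where "P = convex hull range z"
  define Fs where "Fs = {F. F face_of P \<and> aff_dim F = int (CARD('e) - 1)}"
  have img: "projective_map A b c \<delta> ` range y = range z" by (auto simp: z_def)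
  have e: "int (CARD('e) - 1) = int CARD('e) - 1" using zero_less_card_finite[where 'a='e] by linarith
  have poly: "polytope P" unfolding P_def by (rule polytope_hull_range)
  have conv: "convex P" by (simp add: P_def)
  have "card Fs \<le> max 1 (card (cofacets (\<lambda>i. c \<bullet> y i + \<delta>) y))"
  proof (cases "aff_dim P = int CARD('e)")
    case False
    then have "aff_dim P \<le> int (CARD('e) - 1)" using aff_dim_le_DIM[of P] e by simp
    then have "Fs \<subseteq> {P}" using face_of_aff_dim_lt[OF conv] by (force simp: Fs_def)
    then have "card Fs \<le> card {P}" by (intro card_mono) auto
    then show ?thesis by simp
  next
    case True
    have J: "{i. z i \<in> F} \<in> cofacets (\<lambda>i. c \<bullet> y i + \<delta>) y" if "F \<in> Fs" for F
    proof -
      define J where "J = {i. z i \<in> F}"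
      have F: "F face_of P" "aff_dim F = int CARD('e) - 1" using that e by (auto simp: Fs_def)
      then have "F exposed_face_of P"
        using exposed_face_of_polyhedron[OF polytope_imp_polyhedron[OF poly]] by simp
      then obtain a \<alpha> where a: "P \<subseteq> {v. a \<bullet> v \<le> \<alpha>}" "F = P \<inter> {v. a \<bullet> v = \<alpha>}"
        by (auto simp: exposed_face_of_def)
      have zP: "z i \<in> P" for i by (simp add: P_def hull_inc)
      \<comment> \<open>The affine function defining the facet, pulled back along the projective map.\<close>
      define p where "p = \<alpha> *\<^sub>R c - adjoint A a"
      define q where "q = \<alpha> * \<delta> - a \<bullet> b"
      have pull: "p \<bullet> y i + q = (c \<bullet> y i + \<delta>) * (\<alpha> - a \<bullet> z i)" for i
      proof -
        have "(c \<bullet> y i + \<delta>) * (a \<bullet> z i) = a \<bullet> A (y i) + a \<bullet> b"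
          using perm[of i] by (simp add: z_def projective_map_def inner_add_right)
        then show ?thesis
          using adjoint_works[OF lin, of "y i" a]
          by (simp add: p_def q_def algebra_simps inner_commute)
      qed
      have zero: "p \<bullet> y i + q = 0 \<longleftrightarrow> i \<in> J" for i
        using perm[of i] zP[of i] by (auto simp: pull J_def a(2))
      have pos: "(c \<bullet> y i + \<delta>) * (p \<bullet> y i + q) > 0" if "i \<notin> J" for i
      proof -
        have "\<alpha> - a \<bullet> z i > 0" using that a zP[of i] by (fastforce simp: J_def)
        moreover have "(c \<bullet> y i + \<delta>) * (p \<bullet> y i + q) = (c \<bullet> y i + \<delta>)\<^sup>2 * (\<alpha> - a \<bullet> z i)"
          by (simp add: pull power2_eq_square)
        ultimately show ?thesis using perm[of i] by simp
      qed
      have hullF: "F = convex hull (z ` J)"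
        using face_eq_hull_of_vertices F(1) by (simp add: P_def J_def)
      have "J \<noteq> UNIV" using hullF F(2) True by (auto simp: P_def)
      then obtain i where "i \<notin> J" by blast
      with zero[of i] have "p \<noteq> 0 \<or> q \<noteq> 0" by auto
      then have "card J \<le> CARD('e)" using gp_family_hyperplane_card[OF gp] zero by blast
      moreover have "aff_dim (z ` J) \<le> int (card (z ` J)) - 1" by (rule aff_dim_le_card) simp
      then have "CARD('e) \<le> card J"
        using F(2) card_image_le[of J z] by (simp add: hullF aff_dim_convex_hull)
      ultimately show ?thesis
        using zero pos unfolding J_def[symmetric] cofacets_def by auto
    qed
    have "inj_on (\<lambda>F. {i. z i \<in> F}) Fs"
    proof (rule inj_onI)
      fix F G assume "F \<in> Fs" "G \<in> Fs" "{i. z i \<in> F} = {i. z i \<in> G}"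
      then show "F = G" using face_eq_hull_of_vertices[of _ z] unfolding Fs_def P_def
        by (metis (no_types, lifting) mem_Collect_eq)
    qed
    then have "card Fs \<le> card (cofacets (\<lambda>i. c \<bullet> y i + \<delta>) y)"
      using J by (intro card_inj_on_le[where f = "\<lambda>F. {i. z i \<in> F}"]) auto
    then show ?thesis by simp
  qed
  then show ?thesis by (simp add: num_faces_def img P_def Fs_def)
qed

text \<open>The map that divides \<open>v\<close> by \<open>c \<bullet> v + \<delta>\<close> has the inverse \<open>\<delta> v / (1 - c \<bullet> v)\<close>, and it turns relations
  of the images into relations of the points by rescaling coefficients.\<close>

lemma central_map_affine_independent:
  fixes y :: "'i::finite \<Rightarrow> real ^ 'e"
  assumes gp: "gp_family y" and J: "card J \<le> CARD('e) + 1"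
    and \<delta>: "\<delta> \<noteq> 0" and perm: "\<And>i. c \<bullet> y i + \<delta> \<noteq> 0"
  defines "z \<equiv> \<lambda>i. y i /\<^sub>R (c \<bullet> y i + \<delta>)"
  shows "inj z" "\<not> affine_dependent (z ` J)"
proof -
  have y_eq: "y i = (\<delta> / (1 - c \<bullet> z i)) *\<^sub>R z i" for i
  proof -
    define r where "r = c \<bullet> y i + \<delta>"
    have r: "r \<noteq> 0" using perm[of i] by (simp add: r_def)
    have "c \<bullet> z i = (r - \<delta>) / r" by (simp add: z_def r_def divide_inverse)
    then have "1 - c \<bullet> z i = \<delta> / r" using r by (simp add: diff_divide_distrib)
    moreover have "y i = r *\<^sub>R z i" using r by (simp add: z_def flip: r_def)
    ultimately show ?thesis using \<delta> by simp
  qed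
  show inj: "inj z"
  proof (rule injI)
    fix i j assume "z i = z j"
    then have "y i = y j" using y_eq[of i] y_eq[of j] by simp
    then show "i = j" using gp by (simp add: gp_family_def inj_eq)
  qed
  show "\<not> affine_dependent (z ` J)"
  proof
    assume "affine_dependent (z ` J)"
    then obtain U where U: "sum U (z ` J) = 0" "\<exists>v\<in>z ` J. U v \<noteq> 0" "(\<Sum>v\<in>z ` J. U v *\<^sub>R v) = 0"
      unfolding affine_dependent_explicit_finite[OF finite_imageI[OF finite]] by blast
    have injJ: "inj_on z J" using inj by (auto simp: inj_on_def)
    define l where "l i = (if i \<in> J then U (z i) / (c \<bullet> y i + \<delta>) else 0)" for i
    have vec: "(\<Sum>i\<in>UNIV. l i *\<^sub>R y i) = 0"
    proof -
      have "(\<Sum>i\<in>UNIV. l i *\<^sub>R y i) = (\<Sum>i\<in>J. l i *\<^sub>R y i)"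
        by (rule sum.mono_neutral_right) (auto simp: l_def)
      also have "\<dots> = (\<Sum>i\<in>J. U (z i) *\<^sub>R z i)"
        by (rule sum.cong) (auto simp: l_def z_def divide_inverse)
      finally show ?thesis using U(3) by (simp add: sum.reindex[OF injJ])
    qed
    have "(\<Sum>i\<in>UNIV. l i * (c \<bullet> y i + \<delta>)) = (\<Sum>i\<in>J. l i * (c \<bullet> y i + \<delta>))"
      by (rule sum.mono_neutral_right) (auto simp: l_def)
    also have "\<dots> = (\<Sum>i\<in>J. U (z i))"
      by (rule sum.cong) (auto simp: l_def perm)
    finally have "(\<Sum>i\<in>UNIV. l i * (c \<bullet> y i + \<delta>)) = 0"
      using U(1) by (simp add: sum.reindex[OF injJ])
    moreover have "(\<Sum>i\<in>UNIV. l i * (c \<bullet> y i + \<delta>)) = c \<bullet> (\<Sum>i\<in>UNIV. l i *\<^sub>R y i) + (\<Sum>i\<in>UNIV. l i) * \<delta>"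
      by (simp add: algebra_simps sum.distrib inner_sum_right sum_distrib_left)
    ultimately have "affine_relation l y" using vec \<delta> by (simp add: affine_relation_def)
    then have l0: "l i = 0" for i using gp_family_relation_zero[OF gp J, of l i] by (simp add: l_def)
    have "U (z i) = 0" if "i \<in> J" for i
      using that perm[of i] l0[of i] by (simp add: l_def)
    then show False using U(2) by auto
  qed
qed

text \<open>The converse direction, for a nonsingular map: an affine function \<open>\<phi>\<close> that vanishes at \<open>e\<close> points
  and has elsewhere the sign of \<open>\<psi> v = c \<bullet> v + \<delta>\<close> is turned into the equation \<open>\<phi> / \<psi>\<close> of a
  supporting hyperplane of the image.\<close>

lemma card_cofacets_le_num_faces:
  fixes y :: "'i::finite \<Rightarrow> real ^ 'e"
  assumes gp: "gp_family y" and \<delta>: "\<delta> \<noteq> 0" and perm: "\<And>i. c \<bullet> y i + \<delta> \<noteq> 0"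
  shows "card (cofacets (\<lambda>i. c \<bullet> y i + \<delta>) y)
           \<le> num_faces (CARD('e) - 1) (convex hull (projective_map (\<lambda>v. v) 0 c \<delta> ` range y))"
proof -
  define z where "z = (\<lambda>i. y i /\<^sub>R (c \<bullet> y i + \<delta>))"
  define P where "P = convex hull range z"
  define Fs where "Fs = {F. F face_of P \<and> aff_dim F = int (CARD('e) - 1)}"
  have img: "projective_map (\<lambda>v. v) 0 c \<delta> ` range y = range z"
    by (auto simp: z_def projective_map_def)
  have e: "int (CARD('e) - 1) = int CARD('e) - 1" using zero_less_card_finite[where 'a='e] by linarith
  have "finite Fs"
    using finite_polytope_faces[OF polytope_hull_range[of z]]
    by (rule rev_finite_subset) (auto simp: Fs_def P_def)
  have ex: "\<exists>F\<in>Fs. J = {i. z i \<in> F}" if J_in: "J \<in> cofacets (\<lambda>i. c \<bullet> y i + \<delta>) y" for J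
  proof -
    obtain b \<beta> where "\<forall>i\<in>J. b \<bullet> y i + \<beta> = 0" "\<forall>i\<in>-J. (c \<bullet> y i + \<delta>) * (b \<bullet> y i + \<beta>) > 0"
      and "card J = CARD('e)"
      using J_in unfolding cofacets_def by blast
    then have J: "card J = CARD('e)" "\<And>i. i \<in> J \<Longrightarrow> b \<bullet> y i + \<beta> = 0"
      "\<And>i. i \<notin> J \<Longrightarrow> (c \<bullet> y i + \<delta>) * (b \<bullet> y i + \<beta>) > 0"
      by auto
    \<comment> \<open>The affine function whose pullback under the projective map is \<open>b \<bullet> v + \<beta>\<close>.\<close>
    define \<alpha> where "\<alpha> = - (\<beta> / \<delta>)"
    define a where "a = b + \<alpha> *\<^sub>R c"
    have push: "a \<bullet> z i - \<alpha> = (b \<bullet> y i + \<beta>) / (c \<bullet> y i + \<delta>)" for i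
    proof -
      have "a \<bullet> z i = (b \<bullet> y i + \<alpha> * (c \<bullet> y i)) / (c \<bullet> y i + \<delta>)"
        by (simp add: z_def a_def inner_add_left divide_inverse mult.commute)
      then have "(a \<bullet> z i - \<alpha>) * (c \<bullet> y i + \<delta>) = b \<bullet> y i - \<alpha> * \<delta>"
        using perm[of i] by (simp add: field_simps)
      then show ?thesis using perm[of i] \<delta> by (simp add: eq_divide_eq \<alpha>_def)
    qed
    have on: "a \<bullet> z i = \<alpha>" if "i \<in> J" for i using push[of i] J(2)[OF that] by simp
    have off: "a \<bullet> z i > \<alpha>" if "i \<notin> J" for i
    proof -
      have "(b \<bullet> y i + \<beta>) / (c \<bullet> y i + \<delta>) > 0"
        using J(3)[OF that] by (auto simp: zero_less_mult_iff zero_less_divide_iff)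
      then show ?thesis using push[of i] by linarith
    qed
    have "P \<subseteq> {v. a \<bullet> v \<ge> \<alpha>}" unfolding P_def
      using on off by (intro hull_minimal convex_halfspace_ge) (force simp: less_imp_le)
    define F where "F = P \<inter> {v. a \<bullet> v = \<alpha>}"
    have face: "F face_of P" unfolding F_def
      using \<open>P \<subseteq> _\<close> by (intro face_of_Int_supporting_hyperplane_ge) (auto simp: P_def)
    have zP: "z i \<in> P" for i by (simp add: P_def hull_inc)
    have JF: "J = {i. z i \<in> F}"
      using on off zP unfolding F_def by (fastforce simp: order.strict_iff_order)
    have "inj z" and indep: "\<not> affine_dependent (z ` J)"
      using central_map_affine_independent[OF gp _ \<delta> perm, of J] J(1) by (auto simp: z_def)
    then have "aff_dim (z ` J) = int CARD('e) - 1"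
      using J(1) by (simp add: affine_independent_iff_card card_image inj_on_subset)
    then have "aff_dim F = int (CARD('e) - 1)"
      using face_eq_hull_of_vertices[of F z] face e by (metis P_def JF aff_dim_convex_hull)
    with face JF show ?thesis by (auto simp: Fs_def)
  qed
  then obtain G where G: "\<And>J. J \<in> cofacets (\<lambda>i. c \<bullet> y i + \<delta>) y \<Longrightarrow> G J \<in> Fs \<and> J = {i. z i \<in> G J}"
    by metis
  have "card (cofacets (\<lambda>i. c \<bullet> y i + \<delta>) y) \<le> card Fs"
  proof (rule card_inj_on_le[OF _ _ \<open>finite Fs\<close>])
    show "inj_on G (cofacets (\<lambda>i. c \<bullet> y i + \<delta>) y)" by (rule inj_onI) (use G in metis)
    show "G ` cofacets (\<lambda>i. c \<bullet> y i + \<delta>) y \<subseteq> Fs" using G by blast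
  qed
  then show ?thesis by (simp add: num_faces_def img P_def Fs_def)
qed

section \<open>Equality of the extremal numbers\<close>

lemma r_max_eq_Max_circuits:
  fixes x :: "'i::finite \<Rightarrow> real ^ 'd"
  assumes gp: "gp_family x"
  shows "r_max (range x) = Max {card (circuits s x) | s. \<forall>i. s i \<noteq> 0}"
proof -
  have "{radon_count (range x) A B | A B. range x = A \<union> B \<and> A \<inter> B = {}}
      = {card (circuits s x) | s. \<forall>i. s i \<noteq> 0}" (is "?L = ?R")
  proof
    show "?L \<subseteq> ?R"
    proof
      fix m assume "m \<in> ?L"
      then obtain A B where AB: "range x = A \<union> B" "A \<inter> B = {}" "m = radon_count (range x) A B"
        by blast
      define s :: "'i \<Rightarrow> real" where "s = (\<lambda>i. if x i \<in> A then 1 else - 1)"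
      have "m = card (circuits s x)" using radon_count_eq_card_circuits[OF gp AB(1,2)] AB(3) by (simp add: s_def)
      moreover have "\<forall>i. s i \<noteq> 0" by (simp add: s_def)
      ultimately show "m \<in> ?R" by blast
    qed
    show "?R \<subseteq> ?L"
    proof
      fix m assume "m \<in> ?R"
      then obtain s where s: "\<And>i. s i \<noteq> 0" "m = card (circuits s x)" by blast
      define A where "A = x ` {i. s i > 0}"
      define B where "B = x ` {i. s i < 0}"
      have inj: "inj x" using gp by (simp add: gp_family_def)
      have AB: "range x = A \<union> B" "A \<inter> B = {}"
        using s(1) inj by (auto simp: A_def B_def inj_eq neq_iff)
      have "circuits s x = circuits (\<lambda>i. if x i \<in> A then 1 else - 1) x"
        by (rule circuits_sign_cong) (use s(1) inj in \<open>auto simp: A_def inj_image_mem_iff neq_iff\<close>)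
      then have "m = radon_count (range x) A B"
        using radon_count_eq_card_circuits[OF gp AB] s(2) by simp
      with AB show "m \<in> ?L" by blast
    qed
  qed
  then show ?thesis by (simp add: r_max_def)
qed

text \<open>The two sets of numbers differ at most in the values 0 and 1, the first from sign patterns of no
  affine function, both from singular maps. The maximum is not affected, since some sign pattern has
  a positive count.\<close>

lemma h_max_eq_Max_cofacets:
  fixes y :: "'i::finite \<Rightarrow> real ^ 'e"
  assumes gp: "gp_family y" and n: "CARD('i) \<ge> CARD('e) + 1"
  shows "h_max (CARD('e) - 1) (range y) = Max {card (cofacets s y) | s. \<forall>i. s i \<noteq> 0}"
proof -
  define H where "H = {num_faces (CARD('e) - 1) (convex hull (projective_map A b c \<delta> ` range y)) | A b c \<delta>.
            linear A \<and> (c \<noteq> 0 \<or> \<delta> \<noteq> 0) \<and> permissible c \<delta> (range y)}"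
  define C where "C = {card (cofacets s y) | s. \<forall>i. s i \<noteq> 0}"
  have "C \<subseteq> card ` (UNIV :: 'i set set set)" by (auto simp: C_def)
  then have finC: "finite C" by (rule finite_subset) simp
  obtain s0 where s0: "\<And>i. s0 i \<noteq> 0" "cofacets s0 y \<noteq> {}"
    using ex_cofacets_nonempty[OF gp n] by blast
  have "1 \<le> card (cofacets s0 y)" using s0(2) by (simp add: Suc_le_eq card_gt_0_iff)
  moreover have s0C: "card (cofacets s0 y) \<in> C" using s0(1) by (auto simp: C_def)
  ultimately have C1: "1 \<le> Max C" using finC by (meson Max_ge order_trans)
  have upper: "h \<le> Max C" if h_in: "h \<in> H" for h
  proof -
    obtain A b c \<delta> where h: "h = num_faces (CARD('e) - 1) (convex hull (projective_map A b c \<delta> ` range y))"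
      and lin: "linear A" and perm: "permissible c \<delta> (range y)"
      using h_in unfolding H_def by blast
    have perm': "c \<bullet> y i + \<delta> \<noteq> 0" for i using perm by (simp add: permissible_def)
    have "h \<le> max 1 (card (cofacets (\<lambda>i. c \<bullet> y i + \<delta>) y))"
      unfolding h by (rule num_faces_le_card_cofacets[OF gp lin perm'])
    moreover have "card (cofacets (\<lambda>i. c \<bullet> y i + \<delta>) y) \<in> C"
      using perm' unfolding C_def by blast
    then have "card (cofacets (\<lambda>i. c \<bullet> y i + \<delta>) y) \<le> Max C" using finC by (rule Max_ge[rotated])
    ultimately show ?thesis using C1 by linarith
  qed
  have lower: "\<exists>h\<in>H. card (cofacets s y) \<le> h" if s: "\<And>i. s i \<noteq> 0" "cofacets s y \<noteq> {}" for s
  proof -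
    obtain c \<delta> where c: "\<delta> \<noteq> 0" "\<And>i. s i * (c \<bullet> y i + \<delta>) > 0"
      using ex_affine_with_signs[OF gp n s] by blast
    have perm: "c \<bullet> y i + \<delta> \<noteq> 0" for i using c(2)[of i] by auto
    have "cofacets s y = cofacets (\<lambda>i. c \<bullet> y i + \<delta>) y"
      by (rule cofacets_pos_cong) (rule c(2))
    then have "card (cofacets s y)
        \<le> num_faces (CARD('e) - 1) (convex hull (projective_map (\<lambda>v. v) 0 c \<delta> ` range y))"
      using card_cofacets_le_num_faces[OF gp c(1) perm] by simp
    moreover have "\<dots> \<in> H"
      unfolding H_def using c(1) perm linear_ident by (auto simp: permissible_def)
    ultimately show ?thesis by blast
  qed
  have finH: "finite H" using upper by (meson finite_nat_set_iff_bounded_le)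
  have "Max H = Max C"
  proof (rule antisym)
    obtain h0 where "h0 \<in> H" using lower[OF s0] by blast
    then show "Max H \<le> Max C" using finH upper by (intro Max.boundedI) auto
    have "m \<le> Max H" if m: "m \<in> C" for m
    proof -
      obtain s where s: "\<And>i. s i \<noteq> 0" "m = card (cofacets s y)" using m by (auto simp: C_def)
      show ?thesis
      proof (cases "cofacets s y = {}")
        case True
        with s show ?thesis by simp
      next
        case False
        then show ?thesis using lower[OF s(1)] s(2) finH by (meson Max_ge order_trans)
      qed
    qed
    then show "Max C \<le> Max H" using finC s0C by (intro Max.boundedI) auto
  qed
  then show ?thesis by (simp add: h_max_def H_def C_def)
qed

lemma r_max_eq_h_max_if_gale_dual:
  fixes x :: "'i::finite \<Rightarrow> real ^ 'd" and y :: "'i \<Rightarrow> real ^ 'e"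
  assumes dual: "gale_dual w x y" and gpx: "gp_family x" and gpy: "gp_family y"
    and n: "CARD('i) = CARD('d) + CARD('e) + 2"
  shows "r_max (range x) = h_max (CARD('e) - 1) (range y)"
proof -
  have w: "w i \<noteq> 0" for i using dual by (simp add: gale_dual_def)
  have "{card (circuits s x) | s. \<forall>i. s i \<noteq> 0} = {card (cofacets s y) | s. \<forall>i. s i \<noteq> 0}" (is "?L = ?R")
  proof
    show "?L \<subseteq> ?R"
      using card_circuits_eq_card_cofacets[OF dual gpx gpy n] w by fastforce
    show "?R \<subseteq> ?L"
    proof
      fix m assume "m \<in> ?R"
      then obtain s where s: "\<And>i. s i \<noteq> 0" "m = card (cofacets s y)" by blast
      then have "m = card (circuits (\<lambda>i. s i / w i) x)"
        using card_circuits_eq_card_cofacets[OF dual gpx gpy n, of "\<lambda>i. s i / w i"] w by simp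
      moreover have "\<forall>i. s i / w i \<noteq> 0" using s w by simp
      ultimately show "m \<in> ?L" by blast
    qed
  qed
  then show ?thesis
    using r_max_eq_Max_circuits[OF gpx] h_max_eq_Max_cofacets[OF gpy] n by simp
qed

lemma gp_sets_labelling:
  fixes X :: "(real ^ 'd) set"
  assumes "X \<in> gp_sets CARD('i::finite)"
  obtains x :: "'i::finite \<Rightarrow> real ^ 'd" where "range x = X" "gp_family x"
proof -
  have X: "finite X" "card X = CARD('i)" "general_position X"
    using assms by (auto simp: gp_sets_def)
  then obtain x :: "'i \<Rightarrow> real ^ 'd" where "bij_betw x UNIV X"
    using finite_same_card_bij[of "UNIV :: 'i set" X] by auto
  with X(3) show ?thesis by (intro that[of x]) (auto simp: bij_betw_def gp_family_def)
qed

lemma gp_family_range_in_gp_sets: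
  fixes x :: "'i::finite \<Rightarrow> real ^ 'd"
  shows "gp_family x \<Longrightarrow> range x \<in> gp_sets CARD('i)"
  by (simp add: gp_family_def gp_sets_def card_image)

theorem theorem2:
  fixes n :: nat
  assumes "n \<ge> CARD('d::finite) + 3"
    and "CARD('e::finite) = n - CARD('d) - 2"
  shows "r_min TYPE('d) n = H_min (CARD('e) - 1) TYPE('e) n"
proof -
  \<comment> \<open>A label type with exactly \<open>n = (d + 1) + (e + 1)\<close> elements.\<close>
  have n: "n = CARD('d option + 'e option)" using assms by simp
  have card: "CARD('d option + 'e option) = CARD('d) + CARD('e) + 2"
    "CARD('d option + 'e option) = CARD('e) + CARD('d) + 2" by simp_all
  have "{r_max X | X :: (real ^ 'd) set. X \<in> gp_sets n}
      = {h_max (CARD('e) - 1) Y | Y :: (real ^ 'e) set. Y \<in> gp_sets n}" (is "?L = ?R")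
  proof
    show "?L \<subseteq> ?R"
    proof
      fix m assume "m \<in> ?L"
      then obtain X :: "(real ^ 'd) set" where X: "m = r_max X" "X \<in> gp_sets n" by blast
      obtain x :: "'d option + 'e option \<Rightarrow> real ^ 'd" where x: "range x = X" "gp_family x"
        using gp_sets_labelling X(2) n by blast
      obtain w and y :: "'d option + 'e option \<Rightarrow> real ^ 'e" where "gale_dual w x y" "gp_family y"
        using ex_gale_dual[OF x(2) card(1)] by blast
      then have "m = h_max (CARD('e) - 1) (range y)" "range y \<in> gp_sets n"
        using r_max_eq_h_max_if_gale_dual[OF _ x(2) _ card(1)] gp_family_range_in_gp_sets X(1) x(1) n
        by blast+
      then show "m \<in> ?R" by blast
    qed
    show "?R \<subseteq> ?L"
    proof
      fix m assume "m \<in> ?R"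
      then obtain Y :: "(real ^ 'e) set" where Y: "m = h_max (CARD('e) - 1) Y" "Y \<in> gp_sets n" by blast
      obtain y :: "'d option + 'e option \<Rightarrow> real ^ 'e" where y: "range y = Y" "gp_family y"
        using gp_sets_labelling Y(2) n by blast
      obtain w and x :: "'d option + 'e option \<Rightarrow> real ^ 'd" where "gale_dual w y x" "gp_family x"
        using ex_gale_dual[OF y(2) card(2)] by blast
      then have "m = r_max (range x)" "range x \<in> gp_sets n"
        using r_max_eq_h_max_if_gale_dual[OF gale_dual_sym _ y(2) card(1)] gp_family_range_in_gp_sets Y(1) y(1) n
        by metis+
      then show "m \<in> ?L" by blast
    qed
  qed
  then show ?thesis by (simp add: r_min_def H_min_def)
qed

end
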